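(* Let $\mathcal{G}=(\mathcal{V},\mathcal{E})$ be a simple graph with $\mathcal{V}=\{1,\dots,N\}$, adjacency matrix $(a_{ij})$ and graph Laplacian $L$, let $\kappa>0$, and consider the system $$\dot q_i=p_i+\kappa\sum_{j=1}^N a_{ij}\,G_{01}(q_i-q_j,p_i-p_j),\qquad \dot p_i=-\sin q_i-\kappa\sum_{j=1}^N a_{ij}\,G_{10}(q_i-q_j,p_i-p_j),\qquad i=1,\dots,N.$$ Let $\mathcal{S}:=\{(q,p)\in\mathbb{R}^{2N} : q_1=\dots=q_N \text{ and } p_1=\dots=p_N\}$. The eigenvalues associated to a synchronous state in $\mathcal{S}$ with common position $q^{\text{synch}}$ and common momentum $p^{\text{synch}}$ (i.e. the eigenvalues of the Jacobian matrix of the vector field at that state) are $$\pm\sqrt{-\left(1+2\kappa c_{01}\lambda\right)\left(\cos q^{\text{synch}}+2\kappa c_{10}\lambda\right)},\qquad \lambda\in\operatorname{Spec}(L).$$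
   Context: The interaction $G:\mathbb{R}^2\to\mathbb{R}$ is analytic of the form $G(x,y)=\sum_{l,m=0}^\infty c_{lm}x^{2l}y^{2m}$ with $c_{lm}\in\mathbb{R}$, and $G\ge 0$; $c_{10}$ and $c_{01}$ are the coefficients of $x^2$ and $y^2$. Partial derivatives are written $G_{ij}(x,y)=\frac{\partial^{i+j}G}{\partial x^i\partial y^j}(x,y)$. The graph Laplacian is $L=D-A$ with $A=(a_{ij})$ and $D$ the diagonal matrix of node degrees. Square roots are complex square roots. *)

theory Defs
  imports "HOL-Analysis.Analysis"
begin

text \<open>The vertex set is a finite type \<open>'n\<close> with \<open>N = CARD('n)\<close>; a graph is given by its
  edge set.\<close>

definition simple_graph :: "'n set set \<Rightarrow> bool" where
  "simple_graph E \<longleftrightarrow> (\<forall>e\<in>E. card e = 2)"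

definition adjacency :: "'n::finite set set \<Rightarrow> real^'n^'n" where
  "adjacency E = (\<chi> i j. if {i, j} \<in> E then 1 else 0)"

definition degree_matrix :: "'n::finite set set \<Rightarrow> real^'n^'n" where
  "degree_matrix E = (\<chi> i j. if i = j then of_nat (card {e \<in> E. i \<in> e}) else 0)"

definition laplacian :: "'n::finite set set \<Rightarrow> real^'n^'n" where
  "laplacian E = degree_matrix E - adjacency E"

text \<open>Complex eigenvalues of a real matrix, as a set (without multiplicities).\<close>

definition Spec :: "real^'m^'m \<Rightarrow> complex set" where
  "Spec A = {\<mu>. \<exists>v. v \<noteq> 0 \<and> map_matrix complex_of_real A *v v = \<mu> *s v}"

text \<open>The series is required to converge to \<open>G\<close> on the whole plane. Summation over
  \<open>nat \<times> nat\<close> is unconditional; for a power series converging at every point of the plane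
  this is no additional restriction.\<close>

definition even_analytic_interaction ::
    "(nat \<Rightarrow> nat \<Rightarrow> real) \<Rightarrow> (real \<Rightarrow> real \<Rightarrow> real) \<Rightarrow> bool" where
  "even_analytic_interaction c G \<longleftrightarrow>
     (\<forall>x y. ((\<lambda>(l, m). c l m * x ^ (2 * l) * y ^ (2 * m)) has_sum G x y) UNIV) \<and>
     (\<forall>x y. 0 \<le> G x y)"

definition partial_derivative ::
    "nat \<Rightarrow> nat \<Rightarrow> (real \<Rightarrow> real \<Rightarrow> real) \<Rightarrow> real \<Rightarrow> real \<Rightarrow> real" where
  "partial_derivative i j G x y = (deriv ^^ i) (\<lambda>s. (deriv ^^ j) (G s) y) x"

text \<open>The phase space \<open>\<real>\<^sup>2\<^sup>N\<close> is \<open>real^('n + 'n)\<close>: the coordinates \<open>Inl i\<close> are the positions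
  \<open>q\<^sub>i\<close>, the coordinates \<open>Inr i\<close> the momenta \<open>p\<^sub>i\<close>.\<close>

abbreviation pos :: "real^('n + 'n) \<Rightarrow> 'n::finite \<Rightarrow> real" where
  "pos z i \<equiv> z $ Inl i"

abbreviation mom :: "real^('n + 'n) \<Rightarrow> 'n::finite \<Rightarrow> real" where
  "mom z i \<equiv> z $ Inr i"

definition pendulum_network_field ::
    "'n::finite set set \<Rightarrow> real \<Rightarrow> (real \<Rightarrow> real \<Rightarrow> real) \<Rightarrow> real^('n + 'n) \<Rightarrow> real^('n + 'n)" where
  "pendulum_network_field E \<kappa> G z = (\<chi> k. case k of
     Inl i \<Rightarrow> mom z i + \<kappa> * (\<Sum>j\<in>UNIV. adjacency E $ i $ j *
                partial_derivative 0 1 G (pos z i - pos z j) (mom z i - mom z j))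
   | Inr i \<Rightarrow> - sin (pos z i) - \<kappa> * (\<Sum>j\<in>UNIV. adjacency E $ i $ j *
                partial_derivative 1 0 G (pos z i - pos z j) (mom z i - mom z j)))"

definition synchronous_states :: "(real^('n::finite + 'n)) set" where
  "synchronous_states = {z. (\<forall>i j. pos z i = pos z j) \<and> (\<forall>i j. mom z i = mom z j)}"

end

theory Submission
  imports Defs
begin

text \<open>On the synchronous manifold all arguments of the interaction vanish, so only the
  linearisation of its gradient at the origin matters. Since the series contains only even powers,
  every term of \<open>G\<^sub>1\<^sub>0\<close> other than the one of \<open>x\<^sup>2\<close> has total degree at least three, and near the
  origin \<open>G\<^sub>1\<^sub>0(x, y) = 2 c\<^sub>1\<^sub>0 x\<close> up to a cubic error
  (\<open>even_double_series_deriv_estimate\<close>); \<open>G\<^sub>0\<^sub>1\<close> is the same with the variables exchanged.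

  Differentiating the coupling sums then produces \<open>\<Sum>\<^sub>j a\<^sub>i\<^sub>j (u\<^sub>i - u\<^sub>j) = (L u)\<^sub>i\<close>, and the Jacobian is
  the block matrix with zero diagonal blocks, upper right block \<open>B = I + 2 \<kappa> c\<^sub>0\<^sub>1 L\<close> and lower left block
  \<open>- C\<close>, where \<open>C = cos q I + 2 \<kappa> c\<^sub>1\<^sub>0 L\<close> (\<open>pendulum_network_field_has_derivative\<close>).

  An eigenvector \<open>(u, w)\<close> of this matrix with eigenvalue \<open>\<mu>\<close> satisfies \<open>B w = \<mu> u\<close> and
  \<open>C u = - \<mu> w\<close>. As \<open>B\<close> and \<open>C\<close> commute, \<open>B C + \<mu>\<^sup>2\<close> annihilates both \<open>u\<close> and \<open>w\<close>, one of which
  is nonzero. This operator is a polynomial of degree at most two in \<open>L\<close>; splitting it into linear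
  factors shows that one of its roots is an eigenvalue of \<open>L\<close>
  (\<open>eigenvalue_of_quadratic_kernel\<close>). Conversely, every eigenvector of \<open>L\<close> spans with its two copies
  an invariant plane on which the eigenvalue problem is two by two
  (\<open>Spec_antidiagonal_block_shifts\<close>). If the polynomial is constant, every eigenvalue of \<open>L\<close>
  is a root, and the spectrum of \<open>L\<close> is nonempty because \<open>L\<close> annihilates the constant vectors.\<close>

section \<open>Linearisation of the interaction gradient at the origin\<close>

text \<open>For fixed \<open>y\<close> the series is an entire power series \<open>h\<close> in \<open>x\<^sup>2\<close>, so its derivative
  is \<open>2 x h'(x\<^sup>2)\<close>, and it remains to compare \<open>h'(x\<^sup>2)\<close> with \<open>c\<^sub>1\<^sub>0\<close>. The coefficients of \<open>h\<close> depend
  on \<open>y\<close>; for \<open>|y| \<le> 1\<close> they are dominated by the absolute row sums of \<open>c\<close>, which makes all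
  error terms uniform in \<open>y\<close>.\<close>

lemma even_double_series_deriv_estimate:
  fixes c :: "nat \<Rightarrow> nat \<Rightarrow> real" and G :: "real \<Rightarrow> real \<Rightarrow> real"
  assumes G: "\<And>x y. ((\<lambda>(l, m). c l m * x ^ (2 * l) * y ^ (2 * m)) has_sum G x y) UNIV"
  obtains K where "\<And>x y. \<bar>x\<bar> \<le> 1 \<Longrightarrow> \<bar>y\<bar> \<le> 1 \<Longrightarrow>
    \<bar>deriv (\<lambda>s. G s y) x - 2 * c 1 0 * x\<bar> \<le> K * \<bar>x\<bar> * (x\<^sup>2 + y\<^sup>2)"
proof -
  define b where "b y l = (\<Sum>\<^sub>\<infinity>m. c l m * y ^ (2 * m))" for y l
  define B where "B l = (\<Sum>\<^sub>\<infinity>m. \<bar>c l m\<bar>)" for l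
  have abs_summable: "(\<lambda>(l, m). \<bar>c l m\<bar> * \<bar>x\<bar> ^ (2 * l) * \<bar>y\<bar> ^ (2 * m)) summable_on UNIV" for x y
  proof -
    have "(\<lambda>(l, m). c l m * x ^ (2 * l) * y ^ (2 * m)) summable_on UNIV"
      using G by (rule has_sum_imp_summable)
    then have "(\<lambda>p. norm (case p of (l, m) \<Rightarrow> c l m * x ^ (2 * l) * y ^ (2 * m))) summable_on UNIV"
      by (rule summable_on_iff_abs_summable_on_real[THEN iffD1])
    moreover have "(\<lambda>p. norm (case p of (l, m) \<Rightarrow> c l m * x ^ (2 * l) * y ^ (2 * m))) =
        (\<lambda>(l, m). \<bar>c l m\<bar> * \<bar>x\<bar> ^ (2 * l) * \<bar>y\<bar> ^ (2 * m))"
      by (auto simp: abs_mult power_abs)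
    ultimately show ?thesis
      by simp
  qed
  have row_abs: "(\<lambda>m. \<bar>c l m\<bar> * \<bar>y\<bar> ^ (2 * m)) summable_on UNIV" for l y
    using summable_on_SigmaD1[of "\<lambda>l m. \<bar>c l m\<bar> * \<bar>1\<bar> ^ (2 * l) * \<bar>y\<bar> ^ (2 * m)" UNIV "\<lambda>_. UNIV" l]
      abs_summable[of 1 y] by simp
  have row: "((\<lambda>m. c l m * y ^ (2 * m)) has_sum b y l) UNIV" for l y
    unfolding b_def
    by (rule has_sum_infsum, rule abs_summable_summable)
      (use row_abs[of l y] in \<open>simp add: abs_mult power_abs\<close>)
  have row_B: "((\<lambda>m. \<bar>c l m\<bar>) has_sum B l) UNIV" for l
    unfolding B_def using row_abs[of l 1] by (intro has_sum_infsum) simp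
  have b_le_B: "\<bar>b y l\<bar> \<le> B l" if "\<bar>y\<bar> \<le> 1" for y l
  proof -
    have "norm (b y l) \<le> B l"
    proof (rule norm_infsum_le[OF row row_B])
      show "norm (c l m * y ^ (2 * m)) \<le> \<bar>c l m\<bar>" for m
        using that by (simp add: abs_mult power_abs mult_left_le power_le_one)
    qed
    then show ?thesis by simp
  qed
  have B_nonneg: "0 \<le> B l" for l
    using b_le_B[of 0 l] by simp
  have b_near_c: "\<bar>b y l - c l 0\<bar> \<le> B l * y\<^sup>2" if "\<bar>y\<bar> \<le> 1" for y l
  proof -
    have "((\<lambda>m. if m = 0 then - c l 0 else 0) has_sum - c l 0) (UNIV :: nat set)"
      by (rule has_sum_finite_neutralI[of "{0}"]) auto
    from has_sum_add[OF row this]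
    have "((\<lambda>m. c l m * y ^ (2 * m) + (if m = 0 then - c l 0 else 0)) has_sum (b y l - c l 0)) UNIV"
      by simp
    moreover have "(\<lambda>m. c l m * y ^ (2 * m) + (if m = 0 then - c l 0 else 0)) =
        (\<lambda>m. if m = 0 then 0 else c l m * y ^ (2 * m))"
      by auto
    ultimately have "((\<lambda>m. if m = 0 then 0 else c l m * y ^ (2 * m)) has_sum (b y l - c l 0)) UNIV"
      by simp
    moreover have "((\<lambda>m. \<bar>c l m\<bar> * y\<^sup>2) has_sum (B l * y\<^sup>2)) UNIV"
      using row_B by (rule has_sum_cmult_left)
    ultimately have "norm (b y l - c l 0) \<le> B l * y\<^sup>2"
    proof (rule norm_infsum_le)
      fix m
      show "norm (if m = 0 then 0 else c l m * y ^ (2 * m)) \<le> \<bar>c l m\<bar> * y\<^sup>2"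
      proof (cases m)
        case (Suc k)
        have "(y\<^sup>2) ^ k \<le> 1"
          using that by (simp add: power_le_one abs_square_le_1)
        then have "y\<^sup>2 * (y\<^sup>2) ^ k \<le> y\<^sup>2"
          by (simp add: mult_left_le)
        then have "\<bar>c l m\<bar> * (y\<^sup>2 * (y\<^sup>2) ^ k) \<le> \<bar>c l m\<bar> * y\<^sup>2"
          by (rule mult_left_mono) simp
        moreover have "y ^ (2 * m) = y\<^sup>2 * (y\<^sup>2) ^ k"
          unfolding Suc power_mult by simp
        then have "norm (c l m * y ^ (2 * m)) = \<bar>c l m\<bar> * (y\<^sup>2 * (y\<^sup>2) ^ k)"
          by (simp add: abs_mult power_abs)
        ultimately show ?thesis
          using Suc by simp
      qed simp
    qed
    then show ?thesis by simp
  qed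
  have B_summable: "summable (\<lambda>l. B l * t ^ l)" for t :: real
  proof -
    \<comment> \<open>A power series that converges at \<open>x\<^sup>2 = |t| + 1\<close> converges at \<open>t\<close>, also for negative \<open>t\<close>.\<close>
    define x where "x = sqrt (\<bar>t\<bar> + 1)"
    have x: "\<bar>x\<bar> ^ (2 * l) = (\<bar>t\<bar> + 1) ^ l" for l
      by (simp add: x_def power_mult)
    have "(\<lambda>l. B l * (\<bar>t\<bar> + 1) ^ l) summable_on UNIV"
    proof -
      obtain S where "((\<lambda>(l, m). \<bar>c l m\<bar> * (\<bar>t\<bar> + 1) ^ l) has_sum S) UNIV"
        using abs_summable[of x 1] by (auto simp: x summable_on_def)
      then have "((\<lambda>(l, m). \<bar>c l m\<bar> * (\<bar>t\<bar> + 1) ^ l) has_sum S) (Sigma UNIV (\<lambda>_. UNIV))"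
        by simp
      then have "((\<lambda>l. B l * (\<bar>t\<bar> + 1) ^ l) has_sum S) UNIV"
        by (rule has_sum_SigmaD) (auto intro!: has_sum_cmult_left row_B)
      then show ?thesis
        by (rule has_sum_imp_summable)
    qed
    then have "summable (\<lambda>l. B l * (\<bar>t\<bar> + 1) ^ l)"
      by (auto simp: summable_on_def summable_def dest: has_sum_imp_sums)
    then show ?thesis
      by (rule powser_inside) auto
  qed
  define K1 where "K1 = (\<Sum>n. diffs B (Suc n))"
  have diffs_B_summable: "summable (\<lambda>n. diffs B (Suc n))"
    using termdiff_converges_all[OF B_summable, of 1] by (simp add: summable_Suc_iff)
  have b_summable: "summable (\<lambda>l. b y l * t ^ l)" if "\<bar>y\<bar> \<le> 1" for y t :: real
  proof (rule summable_comparison_test')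
    show "summable (\<lambda>l. B l * \<bar>t\<bar> ^ l)"
      by (rule B_summable)
    show "norm (b y l * t ^ l) \<le> B l * \<bar>t\<bar> ^ l" for l
      using b_le_B[OF that] by (simp add: abs_mult power_abs mult_right_mono)
  qed
  have G_series: "G x y = (\<Sum>l. b y l * (x\<^sup>2) ^ l)" for x y
  proof -
    have "((\<lambda>(l, m). c l m * x ^ (2 * l) * y ^ (2 * m)) has_sum G x y) (Sigma UNIV (\<lambda>_. UNIV))"
      using G[of x y] by simp
    then have "((\<lambda>l. b y l * (x\<^sup>2) ^ l) has_sum G x y) UNIV"
    proof (rule has_sum_SigmaD)
      fix l
      show "((\<lambda>m. case (l, m) of (l, m) \<Rightarrow> c l m * x ^ (2 * l) * y ^ (2 * m)) has_sum
          b y l * (x\<^sup>2) ^ l) UNIV"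
        using has_sum_cmult_left[OF row[of l y], of "x ^ (2 * l)"]
        by (simp add: power_mult[symmetric] mult.commute mult.left_commute)
    qed
    then show ?thesis
      by (auto dest!: has_sum_imp_sums sums_unique)
  qed
  have estimate: "\<bar>deriv (\<lambda>s. G s y) x - 2 * c 1 0 * x\<bar> \<le> 2 * (K1 + B 1) * \<bar>x\<bar> * (x\<^sup>2 + y\<^sup>2)"
    if x: "\<bar>x\<bar> \<le> 1" and y: "\<bar>y\<bar> \<le> 1" for x y
  proof -
    define g where "g t = (\<Sum>n. diffs (b y) n * t ^ n)" for t
    have "((\<lambda>t. \<Sum>l. b y l * t ^ l) has_field_derivative g t) (at t)" for t
      unfolding g_def by (rule termdiffs_strong_converges_everywhere) (rule b_summable[OF y])
    moreover have "((\<lambda>s. s\<^sup>2) has_field_derivative 2 * x) (at x)"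
      by (auto intro!: derivative_eq_intros)
    ultimately have "((\<lambda>s. G s y) has_field_derivative g (x\<^sup>2) * (2 * x)) (at x)"
      unfolding G_series by (rule DERIV_chain2)
    then have deriv: "deriv (\<lambda>s. G s y) x = g (x\<^sup>2) * (2 * x)"
      by (rule DERIV_imp_deriv)
    \<comment> \<open>The constant coefficient of \<open>g\<close> is \<open>b y 1\<close>; the remaining terms share a factor \<open>x\<^sup>2\<close>.\<close>
    have "\<bar>g (x\<^sup>2) - b y 1\<bar> \<le> K1 * x\<^sup>2"
    proof -
      have sm: "summable (\<lambda>n. diffs (b y) n * (x\<^sup>2) ^ n)"
        by (rule termdiff_converges_all) (rule b_summable[OF y])
      have "g (x\<^sup>2) - b y 1 = (\<Sum>n. diffs (b y) (Suc n) * (x\<^sup>2) ^ n) * x\<^sup>2"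
        unfolding g_def powser_split_head(2)[OF sm] by (simp add: diffs_def)
      moreover have "norm (\<Sum>n. diffs (b y) (Suc n) * (x\<^sup>2) ^ n) \<le> K1"
        unfolding K1_def
      proof (rule norm_suminf_le[OF _ diffs_B_summable])
        fix n
        have "(x\<^sup>2) ^ n \<le> 1"
          using x by (simp add: power_le_one abs_square_le_1)
        then have "\<bar>b y (Suc (Suc n))\<bar> * (x\<^sup>2) ^ n \<le> B (Suc (Suc n)) * 1"
          using b_le_B[OF y] B_nonneg by (intro mult_mono) auto
        then have "real (Suc (Suc n)) * (\<bar>b y (Suc (Suc n))\<bar> * (x\<^sup>2) ^ n)
            \<le> real (Suc (Suc n)) * (B (Suc (Suc n)) * 1)"
          by (rule mult_left_mono) simp
        then show "norm (diffs (b y) (Suc n) * (x\<^sup>2) ^ n) \<le> diffs B (Suc n)"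
          unfolding diffs_def by (simp add: abs_mult power_abs mult.assoc del: of_nat_Suc)
      qed
      ultimately show ?thesis
        by (simp add: abs_mult mult_right_mono)
    qed
    moreover have "\<bar>b y 1 - c 1 0\<bar> \<le> B 1 * y\<^sup>2"
      by (rule b_near_c[OF y])
    ultimately have "\<bar>g (x\<^sup>2) - c 1 0\<bar> \<le> K1 * x\<^sup>2 + B 1 * y\<^sup>2"
      by linarith
    also have "\<dots> \<le> (K1 + B 1) * (x\<^sup>2 + y\<^sup>2)"
    proof -
      have "0 \<le> K1"
        unfolding K1_def by (intro suminf_nonneg diffs_B_summable) (simp add: diffs_def B_nonneg)
      then show ?thesis
        using B_nonneg[of 1] by (simp add: algebra_simps)
    qed
    finally have "2 * \<bar>x\<bar> * \<bar>g (x\<^sup>2) - c 1 0\<bar> \<le> 2 * \<bar>x\<bar> * ((K1 + B 1) * (x\<^sup>2 + y\<^sup>2))"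
      by (rule mult_left_mono) simp
    moreover have "\<bar>deriv (\<lambda>s. G s y) x - 2 * c 1 0 * x\<bar> = 2 * \<bar>x\<bar> * \<bar>g (x\<^sup>2) - c 1 0\<bar>"
    proof -
      have "deriv (\<lambda>s. G s y) x - 2 * c 1 0 * x = 2 * x * (g (x\<^sup>2) - c 1 0)"
        unfolding deriv by (simp add: algebra_simps)
      then show ?thesis
        by (simp add: abs_mult)
    qed
    ultimately show ?thesis
      by (simp only: mult_ac)
  qed
  then show thesis
    by (rule that)
qed

lemma has_derivative_origin_if_cubic_remainder:
  fixes F :: "real \<times> real \<Rightarrow> real"
  assumes f: "bounded_linear f"
    and F: "\<And>x y. \<bar>x\<bar> \<le> 1 \<Longrightarrow> \<bar>y\<bar> \<le> 1 \<Longrightarrow> \<bar>F (x, y) - f (x, y)\<bar> \<le> K * norm (x, y) ^ 3"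
  shows "(F has_derivative f) (at (0, 0))"
  unfolding has_derivative_at_alt
proof (intro conjI f allI impI)
  fix e :: real
  assume e: "0 < e"
  have zero: "F (0, 0) = 0"
    using F[of 0 0] linear_0[OF bounded_linear.linear[OF f]] by (simp add: zero_prod_def)
  show "\<exists>d>0. \<forall>v. norm (v - (0, 0)) < d \<longrightarrow>
      norm (F v - F (0, 0) - f (v - (0, 0))) \<le> e * norm (v - (0, 0))"
  proof (intro exI conjI allI impI)
    show "0 < min 1 (e / (\<bar>K\<bar> + 1))"
      using e by simp
    fix v :: "real \<times> real"
    assume "norm (v - (0, 0)) < min 1 (e / (\<bar>K\<bar> + 1))"
    then have v: "norm v < 1" "norm v < e / (\<bar>K\<bar> + 1)"
      by (simp_all add: zero_prod_def[symmetric])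
    have "\<bar>fst v\<bar> \<le> 1" "\<bar>snd v\<bar> \<le> 1"
      using v(1) norm_fst_le[of "fst v" "snd v"] norm_snd_le[of "snd v" "fst v"] by auto
    then have "\<bar>F v - f v\<bar> \<le> K * norm v ^ 3"
      using F[of "fst v" "snd v"] by simp
    also have "\<dots> \<le> (\<bar>K\<bar> + 1) * (norm v * norm v)"
    proof (rule mult_mono)
      show "norm v ^ 3 \<le> norm v * norm v"
        using v(1) by (simp add: power3_eq_cube mult_left_le)
    qed auto
    also have "\<dots> \<le> e * norm v"
    proof -
      have "(\<bar>K\<bar> + 1) * norm v \<le> e"
        using v(2) by (simp add: field_simps)
      then have "(\<bar>K\<bar> + 1) * norm v * norm v \<le> e * norm v"
        by (rule mult_right_mono) simp
      then show ?thesis by (simp add: mult.assoc)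
    qed
    finally show "norm (F v - F (0, 0) - f (v - (0, 0))) \<le> e * norm (v - (0, 0))"
      by (simp add: zero) (simp add: zero_prod_def[symmetric])
  qed
qed

lemma even_double_series_deriv_has_derivative_origin:
  fixes c :: "nat \<Rightarrow> nat \<Rightarrow> real" and G :: "real \<Rightarrow> real \<Rightarrow> real"
  assumes "\<And>x y. ((\<lambda>(l, m). c l m * x ^ (2 * l) * y ^ (2 * m)) has_sum G x y) UNIV"
  shows "((\<lambda>v. deriv (\<lambda>s. G s (snd v)) (fst v)) has_derivative (\<lambda>v. 2 * c 1 0 * fst v)) (at (0, 0))"
proof -
  obtain K where K: "\<And>x y. \<bar>x\<bar> \<le> 1 \<Longrightarrow> \<bar>y\<bar> \<le> 1 \<Longrightarrow>
      \<bar>deriv (\<lambda>s. G s y) x - 2 * c 1 0 * x\<bar> \<le> K * \<bar>x\<bar> * (x\<^sup>2 + y\<^sup>2)"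
    using even_double_series_deriv_estimate[OF assms] by blast
  show ?thesis
  proof (rule has_derivative_origin_if_cubic_remainder[where K = "\<bar>K\<bar>"])
    show "bounded_linear (\<lambda>v. 2 * c 1 0 * fst v)"
      by (intro bounded_linear_intros)
    fix x y :: real
    assume xy: "\<bar>x\<bar> \<le> 1" "\<bar>y\<bar> \<le> 1"
    have sq: "x\<^sup>2 + y\<^sup>2 = norm (x, y) ^ 2"
      by (simp add: norm_prod_def)
    have "K * \<bar>x\<bar> * (x\<^sup>2 + y\<^sup>2) \<le> \<bar>K\<bar> * norm (x, y) * norm (x, y) ^ 2"
      unfolding sq using norm_fst_le[of x y] by (intro mult_mono) auto
    also have "\<dots> = \<bar>K\<bar> * norm (x, y) ^ 3"
      by (simp add: power3_eq_cube power2_eq_square)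
    finally show "\<bar>deriv (\<lambda>s. G s (snd (x, y))) (fst (x, y)) - 2 * c 1 0 * fst (x, y)\<bar>
        \<le> \<bar>K\<bar> * norm (x, y) ^ 3"
      using K[OF xy] by simp
  qed
qed

lemma even_analytic_interaction_gradient_derivatives:
  assumes "even_analytic_interaction c G"
  shows "((\<lambda>v. partial_derivative 1 0 G (fst v) (snd v)) has_derivative (\<lambda>v. 2 * c 1 0 * fst v))
      (at (0, 0))"
    and "((\<lambda>v. partial_derivative 0 1 G (fst v) (snd v)) has_derivative (\<lambda>v. 2 * c 0 1 * snd v))
      (at (0, 0))"
proof -
  have G: "((\<lambda>(l, m). c l m * x ^ (2 * l) * y ^ (2 * m)) has_sum G x y) UNIV" for x y
    using assms by (simp add: even_analytic_interaction_def)
  show "((\<lambda>v. partial_derivative 1 0 G (fst v) (snd v)) has_derivative (\<lambda>v. 2 * c 1 0 * fst v))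
      (at (0, 0))"
    using even_double_series_deriv_has_derivative_origin[OF G] by (simp add: partial_derivative_def)
  \<comment> \<open>Exchanging the summation indices makes \<open>y\<close> the first variable, with transposed coefficients.\<close>
  have "((\<lambda>(l, m). c m l * x ^ (2 * l) * y ^ (2 * m)) has_sum G y x) UNIV" for x y
  proof -
    have "((\<lambda>(l, m). c l m * y ^ (2 * l) * x ^ (2 * m)) has_sum G y x) (range prod.swap)"
      using G[of y x] by simp
    then have "((\<lambda>(l, m). c l m * y ^ (2 * l) * x ^ (2 * m)) \<circ> prod.swap has_sum G y x) UNIV"
      by (subst (asm) has_sum_reindex) auto
    then show ?thesis
      by (rule has_sum_cong[THEN iffD1, rotated]) auto
  qed
  from even_double_series_deriv_has_derivative_origin[OF this]
  have "((\<lambda>v. deriv (G (snd v)) (fst v)) has_derivative (\<lambda>v. 2 * c 0 1 * fst v)) (at (0, 0))"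
    by simp
  then have "((\<lambda>v. deriv (G (snd v)) (fst v)) has_derivative (\<lambda>v. 2 * c 0 1 * fst v))
      (at (prod.swap (0, 0)))"
    by simp
  moreover have "(prod.swap has_derivative prod.swap) (at (0 :: real, 0 :: real))"
    unfolding prod.swap_def by (auto intro!: derivative_eq_intros)
  ultimately have "((\<lambda>v. deriv (G (snd (prod.swap v))) (fst (prod.swap v))) has_derivative
      (\<lambda>v. 2 * c 0 1 * fst (prod.swap v))) (at (0, 0))"
    by (rule has_derivative_compose[rotated])
  then show "((\<lambda>v. partial_derivative 0 1 G (fst v) (snd v)) has_derivative (\<lambda>v. 2 * c 0 1 * snd v))
      (at (0, 0))"
    by (simp add: partial_derivative_def)
qed

section \<open>Spectra of antidiagonal block matrices\<close>

text \<open>Over the complex numbers the annihilating quadratic is \<open>\<alpha> (M - r) (M - r')\<close>. Either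
  \<open>(M - r') x\<close> is an eigenvector for \<open>r\<close>, or it vanishes and \<open>x\<close> is one for \<open>r'\<close>. If all three
  coefficients are zero, the equation says nothing about \<open>M\<close> and any eigenvalue will do.\<close>

lemma eigenvalue_of_quadratic_kernel:
  fixes M :: "complex^'n^'n"
  assumes "x \<noteq> 0"
    and x: "\<alpha> *s (M *v (M *v x)) + \<beta> *s (M *v x) + \<gamma> *s x = 0"
    and eigenvalue: "\<exists>lam v. v \<noteq> 0 \<and> M *v v = lam *s v"
  shows "\<exists>lam v. v \<noteq> 0 \<and> M *v v = lam *s v \<and> \<alpha> * lam\<^sup>2 + \<beta> * lam + \<gamma> = 0"
proof (cases "\<alpha> = 0")
  case True
  show ?thesis
  proof (cases "\<beta> = 0")
    case True
    then have "\<gamma> = 0"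
      using x \<open>\<alpha> = 0\<close> \<open>x \<noteq> 0\<close> by simp
    then show ?thesis
      using eigenvalue True \<open>\<alpha> = 0\<close> by auto
  next
    case False
    have "(M *v x) $ i = - \<gamma> / \<beta> * x $ i" for i
    proof -
      have "\<beta> * (M *v x) $ i + \<gamma> * x $ i = 0"
        using arg_cong[OF x, of "\<lambda>v. v $ i"] \<open>\<alpha> = 0\<close> by simp
      then have "\<beta> * (M *v x) $ i = - \<gamma> * x $ i"
        by (simp add: eq_neg_iff_add_eq_0)
      then have "\<beta> * (M *v x) $ i / \<beta> = - \<gamma> * x $ i / \<beta>"
        by simp
      then show ?thesis
        using False by simp
    qed
    then have "M *v x = (- \<gamma> / \<beta>) *s x"
      by (simp only: vec_eq_iff vector_smult_component, simp)
    then show ?thesis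
      using \<open>x \<noteq> 0\<close> False \<open>\<alpha> = 0\<close> by (intro exI[of _ "- \<gamma> / \<beta>"] exI[of _ x]) simp
  qed
next
  case False
  define r where "r = (- \<beta> + csqrt (\<beta>\<^sup>2 - 4 * \<alpha> * \<gamma>)) / (2 * \<alpha>)"
  define r' where "r' = - \<beta> / \<alpha> - r"
  have r: "\<alpha> * r\<^sup>2 + \<beta> * r + \<gamma> = 0"
  proof -
    have "(2 * \<alpha> * r + \<beta>)\<^sup>2 = \<beta>\<^sup>2 - 4 * \<alpha> * \<gamma>"
      using False by (simp add: r_def)
    then have "4 * \<alpha> * (\<alpha> * r\<^sup>2 + \<beta> * r + \<gamma>) = 0"
      by (simp add: power2_eq_square algebra_simps)
    then show ?thesis
      using False by simp
  qed
  have r'_root: "\<alpha> * r'\<^sup>2 + \<beta> * r' + \<gamma> = 0"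
  proof -
    have "\<alpha> * r' = - \<beta> - \<alpha> * r"
      using False by (simp add: r'_def right_diff_distrib)
    then have "\<alpha> * (\<alpha> * r'\<^sup>2 + \<beta> * r' + \<gamma>) = 0"
      using r by algebra
    then show ?thesis
      using False by simp
  qed
  define y where "y = M *v x - r' *s x"
  have y_nth: "y $ i = (M *v x) $ i - r' * x $ i" for i
    by (simp add: y_def)
  have y: "M *v y = r *s y"
  proof -
    have "(M *v y) $ i = (M *v (M *v x)) $ i - r' * (M *v x) $ i" for i
      by (simp add: y_def matrix_vector_mult_diff_distrib vec.scale)
    moreover have "(M *v (M *v x)) $ i = (r + r') * (M *v x) $ i - r * r' * x $ i" for i
    proof -
      have "\<alpha> * (M *v (M *v x)) $ i + \<beta> * (M *v x) $ i + \<gamma> * x $ i = 0"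
        using arg_cong[OF x, of "\<lambda>v. v $ i"] by simp
      moreover have "\<beta> = - \<alpha> * (r + r')"
        using False by (simp add: r'_def)
      moreover from this have "\<gamma> = \<alpha> * r * r'"
        using r by algebra
      ultimately have "\<alpha> * ((M *v (M *v x)) $ i - ((r + r') * (M *v x) $ i - r * r' * x $ i)) = 0"
        by (simp add: algebra_simps)
      then show ?thesis
        using False by simp
    qed
    ultimately have "(M *v y) $ i = (r *s y) $ i" for i
      by (simp add: y_nth algebra_simps)
    then show ?thesis
      unfolding vec_eq_iff by blast
  qed
  show ?thesis
  proof (cases "y = 0")
    case True
    then have "M *v x = r' *s x"
      by (simp add: y_def)
    then show ?thesis
      using \<open>x \<noteq> 0\<close> r'_root by blast
  next
    case False
    then show ?thesis
      using y r by blast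
  qed
qed

definition antidiagonal_block :: "'a::zero^'n^'n \<Rightarrow> 'a^'n^'n \<Rightarrow> 'a^('n + 'n)^('n + 'n)" where
  "antidiagonal_block B C = (\<chi> k l. case k of
     Inl i \<Rightarrow> (case l of Inl j \<Rightarrow> 0 | Inr j \<Rightarrow> B $ i $ j)
   | Inr i \<Rightarrow> (case l of Inl j \<Rightarrow> C $ i $ j | Inr j \<Rightarrow> 0))"

lemma antidiagonal_block_mult:
  fixes B C :: "'a::semiring_1^'n::finite^'n"
  shows "(antidiagonal_block B C *v v) $ Inl i = (B *v (\<chi> j. v $ Inr j)) $ i"
    and "(antidiagonal_block B C *v v) $ Inr i = (C *v (\<chi> j. v $ Inl j)) $ i"
  by (simp_all add: antidiagonal_block_def matrix_vector_mult_def UNIV_Plus_UNIV[symmetric]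
      sum.Plus del: UNIV_Plus_UNIV)

lemma map_matrix_antidiagonal_block:
  assumes "f 0 = 0"
  shows "map_matrix f (antidiagonal_block B C) = antidiagonal_block (map_matrix f B) (map_matrix f C)"
  using assms by (auto simp: vec_eq_iff antidiagonal_block_def split: sum.splits)

lemma map_matrix_of_real_shift_mult:
  fixes L :: "real^'n^'n"
  shows "map_matrix complex_of_real (mat \<alpha> + \<beta> *\<^sub>R L) *v x =
    of_real \<alpha> *s x + of_real \<beta> *s (map_matrix complex_of_real L *v x)"
  by (simp add: vec_eq_iff matrix_vector_mult_def mat_def distrib_right sum.distrib
      sum_distrib_left mult.assoc if_distrib[of complex_of_real] if_distrib[of "\<lambda>a. a * _"]
      cong: if_cong)

lemma Spec_antidiagonal_block_iff:
  fixes B C :: "real^'n::finite^'n"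
  shows "\<mu> \<in> Spec (antidiagonal_block B C) \<longleftrightarrow>
    (\<exists>u w. (u \<noteq> 0 \<or> w \<noteq> 0) \<and> map_matrix complex_of_real B *v w = \<mu> *s u \<and>
      map_matrix complex_of_real C *v u = \<mu> *s w)"
    (is "_ \<longleftrightarrow> (\<exists>u w. ?P u w)")
proof
  assume "\<mu> \<in> Spec (antidiagonal_block B C)"
  then obtain v where v: "v \<noteq> 0"
      "antidiagonal_block (map_matrix complex_of_real B) (map_matrix complex_of_real C) *v v = \<mu> *s v"
    by (auto simp: Spec_def map_matrix_antidiagonal_block)
  have "?P (\<chi> j. v $ Inl j) (\<chi> j. v $ Inr j)"
  proof (intro conjI)
    obtain k where "v $ k \<noteq> 0"
      using v(1) by (auto simp: vec_eq_iff)
    then show "(\<chi> j. v $ Inl j) \<noteq> 0 \<or> (\<chi> j. v $ Inr j) \<noteq> 0"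
      by (cases k) (auto simp: vec_eq_iff)
    show "map_matrix complex_of_real B *v (\<chi> j. v $ Inr j) = \<mu> *s (\<chi> j. v $ Inl j)"
      by (simp add: vec_eq_iff v(2) flip: antidiagonal_block_mult(1)[of _ "map_matrix complex_of_real C"])
    show "map_matrix complex_of_real C *v (\<chi> j. v $ Inl j) = \<mu> *s (\<chi> j. v $ Inr j)"
      by (simp add: vec_eq_iff v(2) flip: antidiagonal_block_mult(2)[of "map_matrix complex_of_real B"])
  qed
  then show "\<exists>u w. ?P u w"
    by blast
next
  assume "\<exists>u w. ?P u w"
  then obtain u w where uw: "?P u w"
    by blast
  define v :: "complex^('n + 'n)" where "v = (\<chi> k. case k of Inl i \<Rightarrow> u $ i | Inr i \<Rightarrow> w $ i)"
  have "antidiagonal_block (map_matrix complex_of_real B) (map_matrix complex_of_real C) *v v = \<mu> *s v"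
    using uw by (auto simp: vec_eq_iff antidiagonal_block_mult v_def split: sum.splits)
  moreover have "v \<noteq> 0"
  proof
    assume "v = 0"
    then have "v $ Inl i = 0" "v $ Inr i = 0" for i
      by simp_all
    then show False
      using uw by (auto simp: v_def vec_eq_iff)
  qed
  ultimately show "\<mu> \<in> Spec (antidiagonal_block B C)"
    unfolding Spec_def by (auto simp: map_matrix_antidiagonal_block)
qed

lemma eq_csqrt_iff: "\<mu> \<in> {csqrt z, - csqrt z} \<longleftrightarrow> \<mu>\<^sup>2 = z"
  using power2_eq_iff[of \<mu> "csqrt z"] by auto

text \<open>Both blocks are affine in \<open>L\<close>, hence commute; eliminating one half of an eigenvector leaves a
  quadratic in \<open>L\<close> acting on the other half.\<close>

lemma Spec_antidiagonal_block_shifts: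
  fixes L :: "real^'n::finite^'n"
  assumes "Spec L \<noteq> {}"
  shows "\<mu> \<in> Spec (antidiagonal_block (mat a + b *\<^sub>R L) (- (mat c + d *\<^sub>R L))) \<longleftrightarrow>
    (\<exists>lam\<in>Spec L. \<mu>\<^sup>2 = - (of_real a + of_real b * lam) * (of_real c + of_real d * lam))"
    (is "_ \<in> Spec ?J \<longleftrightarrow> ?R")
proof -
  define M where "M = map_matrix complex_of_real L"
  define a' b' c' d' where "a' = complex_of_real a" and "b' = complex_of_real b"
    and "c' = complex_of_real c" and "d' = complex_of_real d"
  note defs = M_def[symmetric] a'_def[symmetric] b'_def[symmetric] c'_def[symmetric] d'_def[symmetric]
  have neg: "- (mat c + d *\<^sub>R L) = mat (- c) + (- d) *\<^sub>R L"
    by (simp add: vec_eq_iff mat_def)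
  have iff: "\<mu> \<in> Spec ?J \<longleftrightarrow> (\<exists>u w. (u \<noteq> 0 \<or> w \<noteq> 0) \<and>
      a' *s w + b' *s (M *v w) = \<mu> *s u \<and> (- c') *s u + (- d') *s (M *v u) = \<mu> *s w)"
    unfolding neg Spec_antidiagonal_block_iff map_matrix_of_real_shift_mult of_real_minus defs ..
  show ?thesis
  proof
    assume "\<mu> \<in> Spec ?J"
    then obtain u w where nz: "u \<noteq> 0 \<or> w \<noteq> 0"
      and w: "a' *s w + b' *s (M *v w) = \<mu> *s u"
      and u: "(- c') *s u + (- d') *s (M *v u) = \<mu> *s w"
      unfolding iff by blast
    have Mw: "a' *s (M *v w) + b' *s (M *v (M *v w)) = \<mu> *s (M *v u)"
      using arg_cong[OF w, of "(*v) M"] by (simp add: matrix_vector_right_distrib vec.scale)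
    have Mu: "(- c') *s (M *v u) + (- d') *s (M *v (M *v u)) = \<mu> *s (M *v w)"
      using arg_cong[OF u, of "(*v) M"]
      unfolding matrix_vector_right_distrib vec.scale .
    have comp: "a' * w $ i + b' * (M *v w) $ i = \<mu> * u $ i"
        "- c' * u $ i + - d' * (M *v u) $ i = \<mu> * w $ i"
        "a' * (M *v w) $ i + b' * (M *v (M *v w)) $ i = \<mu> * (M *v u) $ i"
        "- c' * (M *v u) $ i + - d' * (M *v (M *v u)) $ i = \<mu> * (M *v w) $ i" for i
      using arg_cong[OF w, of "\<lambda>v. v $ i"] arg_cong[OF u, of "\<lambda>v. v $ i"]
        arg_cong[OF Mw, of "\<lambda>v. v $ i"] arg_cong[OF Mu, of "\<lambda>v. v $ i"] by simp_all
    \<comment> \<open>The same quadratic annihilates both halves, so any nonzero half can be used.\<close>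
    have "\<exists>x. x \<noteq> 0 \<and> (b' * d') *s (M *v (M *v x)) + (a' * d' + b' * c') *s (M *v x) +
        (a' * c' + \<mu>\<^sup>2) *s x = 0"
    proof (cases "u = 0")
      case True
      have "b' * d' * (M *v (M *v w)) $ i + (a' * d' + b' * c') * (M *v w) $ i +
        (a' * c' + \<mu>\<^sup>2) * w $ i = 0" for i
        using comp[of i] by algebra
      then show ?thesis
        using True nz by (intro exI[of _ w])
          (simp only: vec_eq_iff[of _ 0] vector_add_component vector_smult_component zero_index, simp)
    next
      case False
      have "b' * d' * (M *v (M *v u)) $ i + (a' * d' + b' * c') * (M *v u) $ i +
        (a' * c' + \<mu>\<^sup>2) * u $ i = 0" for i
        using comp[of i] by algebra
      then show ?thesis
        using False by (intro exI[of _ u])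
          (simp only: vec_eq_iff[of _ 0] vector_add_component vector_smult_component zero_index, simp)
    qed
    then obtain x where x: "x \<noteq> 0" "(b' * d') *s (M *v (M *v x)) + (a' * d' + b' * c') *s (M *v x) +
        (a' * c' + \<mu>\<^sup>2) *s x = 0"
      by blast
    obtain lam v where lam: "v \<noteq> 0" "M *v v = lam *s v"
      "b' * d' * lam\<^sup>2 + (a' * d' + b' * c') * lam + (a' * c' + \<mu>\<^sup>2) = 0"
      using eigenvalue_of_quadratic_kernel[OF x] assms unfolding Spec_def defs by blast
    show ?R
    proof (rule bexI)
      show "lam \<in> Spec L"
        unfolding Spec_def defs using lam by blast
      show "\<mu>\<^sup>2 = - (of_real a + of_real b * lam) * (of_real c + of_real d * lam)"
        unfolding defs using lam(3) by algebra
    qed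
  next
    assume ?R
    then obtain lam x where x: "x \<noteq> 0" "M *v x = lam *s x"
      and \<mu>: "\<mu>\<^sup>2 = - (a' + b' * lam) * (c' + d' * lam)"
      unfolding Spec_def defs by blast
    \<comment> \<open>The eigenvector is sought as \<open>(s x, t x)\<close>. The generic choice \<open>s = a + b lam\<close>, \<open>t = \<mu>\<close>
        degenerates to zero when \<open>a + b lam = 0\<close>, since then \<open>\<mu> = 0\<close>.\<close>
    define s t where "s = (if a' + b' * lam = 0 then 0 else a' + b' * lam)"
      and "t = (if a' + b' * lam = 0 then 1 else \<mu>)"
    have "(a' + b' * lam) * t = \<mu> * s \<and> - (c' + d' * lam) * s = \<mu> * t \<and> (s \<noteq> 0 \<or> t \<noteq> 0)"
    proof (cases "a' + b' * lam = 0")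
      case True
      then have "\<mu>\<^sup>2 = 0"
        unfolding \<mu> True by simp
      then show ?thesis
        using True by (simp add: s_def t_def)
    next
      case False
      moreover have "- (c' + d' * lam) * (a' + b' * lam) = \<mu> * \<mu>"
        using \<mu> by algebra
      ultimately show ?thesis
        by (simp add: s_def t_def)
    qed
    then have st: "(a' + b' * lam) * t = \<mu> * s" "- (c' + d' * lam) * s = \<mu> * t" "s \<noteq> 0 \<or> t \<noteq> 0"
      by blast+
    show "\<mu> \<in> Spec ?J"
      unfolding iff
    proof (intro exI conjI)
      show "s *s x \<noteq> 0 \<or> t *s x \<noteq> 0"
        using st(3) x(1) by simp
      have "a' * (t * x $ i) + b' * (t * (lam * x $ i)) = \<mu> * (s * x $ i)" for i
        using st(1) by algebra
      then show "a' *s (t *s x) + b' *s (M *v (t *s x)) = \<mu> *s (s *s x)"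
        by (simp add: vec_eq_iff vec.scale x(2) mult.assoc)
      have "- c' * (s * x $ i) + - d' * (s * (lam * x $ i)) = \<mu> * (t * x $ i)" for i
        using st(2) by algebra
      then show "(- c') *s (s *s x) + (- d') *s (M *v (s *s x)) = \<mu> *s (t *s x)"
        by (simp add: vec_eq_iff vec.scale x(2) mult.assoc)
    qed
  qed
qed

section \<open>The graph Laplacian\<close>

text \<open>An edge at \<open>i\<close> has exactly two elements, so it is determined by its other endpoint.\<close>

lemma degree_eq_adjacency_sum:
  assumes "simple_graph E"
  shows "(\<Sum>j\<in>UNIV. adjacency E $ i $ j) = real (card {e \<in> E. i \<in> e})"
proof -
  have "bij_betw (\<lambda>j. {i, j}) {j. {i, j} \<in> E} {e \<in> E. i \<in> e}"
  proof (rule bij_betwI')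
    show "({i, j} = {i, k}) = (j = k)" for j k
      by (auto simp: doubleton_eq_iff)
    show "\<exists>j\<in>{j. {i, j} \<in> E}. e = {i, j}" if e: "e \<in> {e \<in> E. i \<in> e}" for e
    proof -
      obtain x y where "e = {x, y}"
        using e assms unfolding simple_graph_def card_2_iff by blast
      then have "e = {i, x} \<or> e = {i, y}"
        using e by auto
      then show ?thesis
        using e by auto
    qed
  qed auto
  then have "card {j. {i, j} \<in> E} = card {e \<in> E. i \<in> e}"
    by (rule bij_betw_same_card)
  then show ?thesis
    by (simp add: adjacency_def sum.If_cases)
qed

lemma laplacian_mult:
  assumes "simple_graph E"
  shows "(laplacian E *v u) $ i = (\<Sum>j\<in>UNIV. adjacency E $ i $ j * (u $ i - u $ j))"
proof -
  have "(degree_matrix E *v u) $ i = (\<Sum>j\<in>UNIV. adjacency E $ i $ j) * u $ i"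
    by (simp add: degree_eq_adjacency_sum[OF assms] degree_matrix_def matrix_vector_mult_def
        if_distrib[of "\<lambda>a. a * _"] cong: if_cong)
  then show ?thesis
    by (simp add: laplacian_def matrix_vector_mult_diff_rdistrib)
      (simp add: matrix_vector_mult_def sum_distrib_left sum_subtractf algebra_simps)
qed

lemma zero_in_Spec_laplacian:
  assumes "simple_graph E"
  shows "0 \<in> Spec (laplacian E)"
proof -
  have "(\<Sum>j\<in>UNIV. laplacian E $ i $ j) = 0" for i
    using laplacian_mult[OF assms, of "\<chi> j. 1" i] by (simp add: matrix_vector_mult_def)
  then have "map_matrix complex_of_real (laplacian E) *v (\<chi> j. 1) = 0 *s (\<chi> j. 1)"
    by (simp add: vec_eq_iff matrix_vector_mult_def flip: of_real_sum)
  moreover have "(\<chi> j. (1 :: complex)) \<noteq> 0"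
    by (simp add: vec_eq_iff)
  ultimately show ?thesis
    unfolding Spec_def by blast
qed

section \<open>The Jacobian at a synchronous state\<close>

lemma has_derivative_vec_nthI:
  fixes f :: "'a::real_normed_vector \<Rightarrow> real^'m"
  assumes "\<And>k. ((\<lambda>x. f x $ k) has_derivative (\<lambda>h. f' h $ k)) (at x)"
  shows "(f has_derivative f') (at x)"
  unfolding has_derivative_componentwise_within[of f]
  by (auto simp: Basis_vec_def inner_axis intro: assms)

text \<open>At a synchronous state every pair of oscillators feels the interaction at the origin, with
  the same linear response; summing it over the neighbours of \<open>i\<close> is the action of the Laplacian.\<close>

lemma pendulum_network_field_has_derivative:
  fixes z :: "real^('n::finite + 'n)"
  assumes E: "simple_graph E"
    and G10: "((\<lambda>v. partial_derivative 1 0 G (fst v) (snd v)) has_derivative (\<lambda>v. \<alpha> * fst v))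
      (at (0, 0))"
    and G01: "((\<lambda>v. partial_derivative 0 1 G (fst v) (snd v)) has_derivative (\<lambda>v. \<beta> * snd v))
      (at (0, 0))"
    and q: "\<And>i. pos z i = q" and p: "\<And>i. mom z i = p"
  shows "(pendulum_network_field E \<kappa> G has_derivative
    (*v) (antidiagonal_block (mat 1 + (\<kappa> * \<beta>) *\<^sub>R laplacian E)
      (- (mat (cos q) + (\<kappa> * \<alpha>) *\<^sub>R laplacian E)))) (at z)"
    (is "(_ has_derivative (*v) ?J) _")
proof (rule has_derivative_vec_nthI)
  fix k
  have shift: "((mat \<gamma> + \<delta> *\<^sub>R laplacian E) *v u) $ i =
      \<gamma> * u $ i + \<delta> * (\<Sum>j\<in>UNIV. adjacency E $ i $ j * (u $ i - u $ j))"
    for \<gamma> \<delta> :: real and u i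
    using laplacian_mult[OF E, of u i]
    by (simp add: matrix_vector_mult_add_rdistrib scaleR_matrix_vector_assoc[symmetric])
      (simp add: matrix_vector_mult_def mat_def if_distrib[of "\<lambda>a. a * _"] cong: if_cong)
  \<comment> \<open>The coupling depends on the state only through these linear maps, which vanish at \<open>z\<close>.\<close>
  define D where "D i j y = (pos y i - pos y j, mom y i - mom y j)" for y :: "real^('n + 'n)" and i j
  have D: "(D i j has_derivative D i j) (at z)" for i j
    unfolding D_def[abs_def]
    by (intro has_derivative_Pair has_derivative_diff bounded_linear_imp_has_derivative
        bounded_linear_vec_nth)
  have "D i j z = (0, 0)" for i j
    by (simp add: D_def q p)
  then have G10': "((\<lambda>y. partial_derivative 1 0 G (fst (D i j y)) (snd (D i j y))) has_derivative
        (\<lambda>h. \<alpha> * fst (D i j h))) (at z)"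
    and G01': "((\<lambda>y. partial_derivative 0 1 G (fst (D i j y)) (snd (D i j y))) has_derivative
        (\<lambda>h. \<beta> * snd (D i j h))) (at z)" for i j
    using has_derivative_compose[OF D[of i j], of "\<lambda>v. partial_derivative 1 0 G (fst v) (snd v)"] G10
      has_derivative_compose[OF D[of i j], of "\<lambda>v. partial_derivative 0 1 G (fst v) (snd v)"] G01
    by simp_all
  show "((\<lambda>y. pendulum_network_field E \<kappa> G y $ k) has_derivative (\<lambda>h. (?J *v h) $ k)) (at z)"
  proof (cases k)
    case (Inl i)
    have "((\<lambda>y. mom y i + \<kappa> * (\<Sum>j\<in>UNIV. adjacency E $ i $ j *
          partial_derivative 0 1 G (fst (D i j y)) (snd (D i j y)))) has_derivative
        (\<lambda>h. mom h i + \<kappa> * (\<Sum>j\<in>UNIV. adjacency E $ i $ j * (\<beta> * snd (D i j h))))) (at z)"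
      by (intro has_derivative_add has_derivative_mult_right has_derivative_sum G01'
          bounded_linear_imp_has_derivative bounded_linear_vec_nth)
    then show ?thesis
      by (simp add: Inl pendulum_network_field_def antidiagonal_block_mult shift D_def
          sum_distrib_left mult_ac)
  next
    case (Inr i)
    have sin: "((\<lambda>y. sin (pos y i)) has_derivative (\<lambda>h. cos q * pos h i)) (at z)"
    proof -
      have "((\<lambda>y. sin (pos y i)) has_derivative (\<lambda>h. pos h i * cos (pos z i))) (at z)"
        by (intro has_derivative_sin bounded_linear_imp_has_derivative bounded_linear_vec_nth)
      then show ?thesis
        by (simp add: q mult.commute)
    qed
    have deriv: "((\<lambda>y. - sin (pos y i) - \<kappa> * (\<Sum>j\<in>UNIV. adjacency E $ i $ j *
          partial_derivative 1 0 G (fst (D i j y)) (snd (D i j y)))) has_derivative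
        (\<lambda>h. - (cos q * pos h i) - \<kappa> * (\<Sum>j\<in>UNIV. adjacency E $ i $ j * (\<alpha> * fst (D i j h)))))
        (at z)"
      by (intro has_derivative_diff has_derivative_minus has_derivative_mult_right
          has_derivative_sum G10' sin)
    have J_nth: "(?J *v h) $ k =
        - (cos q * pos h i) - \<kappa> * (\<Sum>j\<in>UNIV. adjacency E $ i $ j * (\<alpha> * fst (D i j h)))" for h
    proof -
      have "((- N) *v u) $ i = - (N *v u) $ i" for N :: "real^'n^'n" and u
        by (simp add: matrix_vector_mult_def sum_negf)
      then show ?thesis
        unfolding Inr antidiagonal_block_mult
        by (simp only: shift) (simp add: D_def sum_distrib_left mult_ac)
    qed
    show ?thesis
      unfolding J_nth using deriv by (simp add: Inr pendulum_network_field_def D_def)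
  qed
qed

theorem proposition4:
  fixes E :: "'n::finite set set"
    and \<kappa> :: real
    and c :: "nat \<Rightarrow> nat \<Rightarrow> real"
    and G :: "real \<Rightarrow> real \<Rightarrow> real"
    and z :: "real^('n + 'n)"
    and qsynch psynch :: real
  assumes "simple_graph E"
    and "\<kappa> > 0"
    and "even_analytic_interaction c G"
    and "z \<in> synchronous_states"
    and "\<forall>i. pos z i = qsynch"
    and "\<forall>i. mom z i = psynch"
  shows "pendulum_network_field E \<kappa> G differentiable (at z) \<and>
    Spec (jacobian (pendulum_network_field E \<kappa> G) (at z)) =
      (\<Union>lam\<in>Spec (laplacian E).
         let s = csqrt (- (1 + 2 * of_real \<kappa> * of_real (c 0 1) * lam) *
                          (of_real (cos qsynch) + 2 * of_real \<kappa> * of_real (c 1 0) * lam))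
         in {s, - s})"
proof -
  let ?J = "antidiagonal_block (mat 1 + (\<kappa> * (2 * c 0 1)) *\<^sub>R laplacian E)
      (- (mat (cos qsynch) + (\<kappa> * (2 * c 1 0)) *\<^sub>R laplacian E))"
  have deriv: "(pendulum_network_field E \<kappa> G has_derivative (*v) ?J) (at z)"
    by (rule pendulum_network_field_has_derivative[OF assms(1)
          even_analytic_interaction_gradient_derivatives[OF assms(3)]])
      (use assms(5,6) in auto)
  have jacobian: "jacobian (pendulum_network_field E \<kappa> G) (at z) = ?J"
    unfolding jacobian_def frechet_derivative_at[OF deriv, symmetric]
    by (rule matrix_of_matrix_vector_mul)
  have nonempty: "Spec (laplacian E) \<noteq> {}"
    using zero_in_Spec_laplacian[OF assms(1)] by blast
  have "Spec ?J = (\<Union>lam\<in>Spec (laplacian E).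
      let s = csqrt (- (1 + 2 * of_real \<kappa> * of_real (c 0 1) * lam) *
                       (of_real (cos qsynch) + 2 * of_real \<kappa> * of_real (c 1 0) * lam))
      in {s, - s})"
  proof (rule set_eqI)
    fix \<mu>
    show "\<mu> \<in> Spec ?J \<longleftrightarrow> \<mu> \<in> (\<Union>lam\<in>Spec (laplacian E).
        let s = csqrt (- (1 + 2 * of_real \<kappa> * of_real (c 0 1) * lam) *
                         (of_real (cos qsynch) + 2 * of_real \<kappa> * of_real (c 1 0) * lam))
        in {s, - s})"
      unfolding Spec_antidiagonal_block_shifts[OF nonempty] UN_iff Let_def eq_csqrt_iff
      by (simp only: of_real_mult of_real_numeral of_real_1 mult_ac)
  qed
  then show ?thesis
    unfolding jacobian using deriv by (auto simp: differentiable_def)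
qed

end
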